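(* The Euler totient function $(\varphi(n))_{n\geq 1}$ is not $k$-regular for any integer $k\geq 2$.
   Context: An integer sequence $(s(n))$ is $k$-regular if its $k$-kernel $\{(s(k^l n+r))_{n}: l\geq 0,\ 0\leq r<k^l\}$ is contained in the $\mathbb{Z}$-linear span of finitely many integer sequences. *)

theory Defs
  imports "HOL-Number_Theory.Totient"
begin

text \<open>
  A sequence \<open>(s(n))\<close> indexed by \<open>n \<ge> m\<close> is given by a function \<open>s\<close> on the naturals of which only
  the values at \<open>n \<ge> m\<close> matter. The members of its \<open>k\<close>-kernel are again indexed by \<open>n \<ge> m\<close>; they
  are stored with the index shifted to start at 0, so that they are total functions on the naturals
  with no junk value: the \<open>i\<close>-th entry is the one for \<open>n = m + i\<close>. The choice \<open>m = 0\<close> gives the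
  \<open>k\<close>-kernel of a sequence indexed by all naturals.
\<close>

definition k_kernel :: "nat \<Rightarrow> nat \<Rightarrow> (nat \<Rightarrow> int) \<Rightarrow> (nat \<Rightarrow> int) set" where
  "k_kernel m k s = {(\<lambda>i. s (k ^ l * (m + i) + r)) | l r. r < k ^ l}"

text \<open>Only meaningful for finite \<open>B\<close>.\<close>

definition int_span :: "(nat \<Rightarrow> int) set \<Rightarrow> (nat \<Rightarrow> int) set" where
  "int_span B = {(\<lambda>i. \<Sum>b\<in>B. c b * b i) | c. True}"

definition k_regular :: "nat \<Rightarrow> nat \<Rightarrow> (nat \<Rightarrow> int) \<Rightarrow> bool" where
  "k_regular m k s \<longleftrightarrow> (\<exists>B. finite B \<and> k_kernel m k s \<subseteq> int_span B)"

end

theory Submission imports Defs "HOL-Number_Theory.Residues" begin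

text \<open>
  Suppose that the kernel lies in the span of \<open>d\<close> sequences. Take \<open>d + 1\<close> odd primes not dividing
  \<open>k\<close> and a power \<open>K\<close> of \<open>k\<close> exceeding all of them. Then some nontrivial integer relation
  \<open>\<Sum>p. c p * \<phi>(K * n + p) = 0\<close> between these primes \<open>p\<close> holds for all \<open>n \<ge> 1\<close>. Fix \<open>p\<close> with
  \<open>c p \<noteq> 0\<close> and choose \<open>n\<close> such that \<open>K * n + p\<close> is a power \<open>p ^ e\<close> while each other \<open>K * n + q\<close>
  has more than \<open>M\<close> prime factors. The latter makes \<open>\<phi>(K * n + q)\<close> divisible by \<open>2 ^ M\<close>, so \<open>2 ^ M\<close>
  divides \<open>c p * (p - 1)\<close>. As \<open>M\<close> is arbitrary, this is absurd.
\<close>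

text \<open>Fraction-free Gaussian elimination, one column \<open>b0\<close> at a time: a pivot row
  \<open>j0\<close> clears the column by cross-multiplication, so all coefficients stay
  integers.\<close>

lemma exists_integer_relation:
  fixes a :: "'j \<Rightarrow> 'b \<Rightarrow> int"
  assumes "finite B" "finite J" "card B < card J"
  shows "\<exists>c. (\<exists>j\<in>J. c j \<noteq> 0) \<and> (\<forall>b\<in>B. (\<Sum>j\<in>J. c j * a j b) = 0)"
  using assms
proof (induction B arbitrary: J a rule: finite_induct)
  case empty
  then have "J \<noteq> {}" by auto
  then show ?case by (intro exI[of _ "\<lambda>_. 1"]) auto
next
  case (insert b0 B)
  show ?case
  proof (cases "\<forall>j\<in>J. a j b0 = 0")
    case True
    have "card B < card J" using insert by simp
    with insert.IH[OF insert.prems(1), of a] True show ?thesis by auto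
  next
    case False
    then obtain j0 where j0: "j0 \<in> J" "a j0 b0 \<noteq> 0" by blast
    define J' where "J' = J - {j0}"
    have J: "J = insert j0 J'" "j0 \<notin> J'" "finite J'"
      using j0 insert.prems by (auto simp: J'_def)
    have "card B < card J'" using insert J by simp
    from insert.IH[OF J(3) this, of "\<lambda>j b. a j0 b0 * a j b - a j b0 * a j0 b"]
    obtain c where c: "\<exists>j\<in>J'. c j \<noteq> 0"
      "\<And>b. b \<in> B \<Longrightarrow> (\<Sum>j\<in>J'. c j * (a j0 b0 * a j b - a j b0 * a j0 b)) = 0"
      by blast
    \<comment> \<open>The coefficient at \<open>j0\<close> collects the multiples of the pivot row
      that were subtracted; the others are scaled by the nonzero pivot
      \<open>a j0 b0\<close>.\<close>
    define c' where "c' j = (if j = j0 then - (\<Sum>j\<in>J'. c j * a j b0) else c j * a j0 b0)" for j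
    have c'_sum: "(\<Sum>j\<in>J. c' j * a j b) =
        (\<Sum>j\<in>J'. c j * (a j0 b0 * a j b - a j b0 * a j0 b))" for b
    proof -
      have "(\<Sum>j\<in>J'. c' j * a j b) = (\<Sum>j\<in>J'. c j * a j0 b0 * a j b)"
        using J(2) by (intro sum.cong) (auto simp: c'_def)
      then show ?thesis
        using J by (simp add: c'_def algebra_simps sum_subtractf sum_distrib_left sum_distrib_right)
    qed
    have "(\<Sum>j\<in>J. c' j * a j b) = 0" if "b \<in> insert b0 B" for b
      using that c(2) by (auto simp: c'_sum)
    moreover from c(1) obtain j where "j \<in> J'" "c j \<noteq> 0" by blast
    then have "j \<in> J \<and> c' j \<noteq> 0" using J j0 by (auto simp: c'_def)
    ultimately show ?thesis by blast
  qed
qed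

text \<open>In the product formula for the totient each odd prime factor \<open>p\<close>
  contributes an even factor \<open>p - 1\<close>. The strict inequality allows for the prime 2,
  which may contribute nothing.\<close>

lemma two_power_dvd_totient:
  assumes "M < card (prime_factors n)"
  shows "2 ^ M dvd totient n"
proof -
  have "n > 0" using assms by (cases "n = 0") auto
  define P where "P = prime_factors n - {2}"
  have "M \<le> card P" using assms by (auto simp: P_def card_Diff_singleton_if)
  then have "2 ^ M dvd (2::nat) ^ card P" by (rule le_imp_power_dvd)
  also have "2 ^ card P = (\<Prod>p\<in>P. 2::nat)" by simp
  also have "\<dots> dvd (\<Prod>p\<in>P. p ^ (multiplicity p n - 1) * (p - 1))"
  proof (rule prod_dvd_prod)
    fix p assume "p \<in> P"
    then have "prime p" "p \<noteq> 2" by (auto simp: P_def)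
    then have "odd p" using primes_dvd_imp_eq two_is_prime_nat by blast
    then show "2 dvd p ^ (multiplicity p n - 1) * (p - 1)" by simp
  qed
  also have "\<dots> dvd (\<Prod>p\<in>prime_factors n. p ^ (multiplicity p n - 1) * (p - 1))"
    by (rule prod_dvd_prod_subset) (auto simp: P_def)
  also have "\<dots> = totient n"
    using \<open>n > 0\<close> by (simp add: totient_formula1)
  finally show ?thesis .
qed

lemma card_prime_factors_mult_coprime_less:
  fixes y z :: nat
  assumes "coprime y z" "y > 0" "z > 1"
  shows "card (prime_factors y) < card (prime_factors (y * z))"
proof -
  obtain r where r: "prime r" "r dvd z" using assms(3) prime_factor_nat[of z] by auto
  then have "\<not> r dvd y" using assms(1) not_coprimeI not_prime_unit by blast
  then have "r \<notin> prime_factors y" by auto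
  moreover have "r \<in> prime_factors (y * z)"
    using r assms by (auto simp: prime_factors_dvd)
  moreover have "prime_factors y \<subseteq> prime_factors (y * z)"
    using assms by (auto simp: prime_factors_dvd)
  ultimately show ?thesis by (intro psubset_card_mono) auto
qed

text \<open>
  Passing from \<open>p ^ e\<close> to \<open>p ^ (e + totient Q)\<close>, where \<open>Q\<close> is divisible by \<open>y\<^sup>2\<close>, replaces the shift
  \<open>y = K * n + q\<close> by some \<open>y * (1 + y * u)\<close>, whose second factor contributes a new prime.
\<close>

lemma prime_power_with_many_prime_factors_in_shifts:
  fixes p K :: nat and H :: "nat set"
  assumes p: "prime p" and K: "coprime p K" "K > 0"
    and H: "finite H" "\<And>q. q \<in> H \<Longrightarrow> coprime p q \<and> q > 0"
  shows "\<exists>n e. n > 0 \<and> e > 0 \<and> K * n + p = p ^ e \<and>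
    (\<forall>q\<in>H. m \<le> card (prime_factors (K * n + q)))"
proof (induction m)
  case 0
  \<comment> \<open>The exponent \<open>totient K + 1\<close> gives a power of \<open>p\<close>
    congruent to \<open>p\<close> modulo \<open>K\<close> and larger than \<open>p\<close>.\<close>
  have "[p ^ totient K = 1] (mod K)" using K by (intro euler_theorem) auto
  then have "[p * p ^ totient K = p * 1] (mod K)" by (rule cong_scalar_left)
  then have "K dvd p * p ^ totient K - p"
    using p by (intro cong_altdef_nat[THEN iffD1]) (auto simp: prime_gt_0_nat Suc_le_eq)
  then obtain n where n: "p * p ^ totient K - p = K * n" by (elim dvdE)
  have "p ^ 1 < p ^ (Suc (totient K))"
    using prime_gt_1_nat[OF p] K by (intro power_strict_increasing) auto
  then have "p < p * p ^ totient K" by (simp only: power_Suc power_one_right)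
  with n have "K * n > 0" "K * n + p = p * p ^ totient K" by linarith+
  then have "n > 0" "K * n + p = p ^ Suc (totient K)" by simp_all
  then show ?case by blast
next
  case (Suc m)
  then obtain n e where n: "n > 0" "e > 0" "K * n + p = p ^ e"
    and m: "\<And>q. q \<in> H \<Longrightarrow> m \<le> card (prime_factors (K * n + q))"
    by blast
  \<comment> \<open>The factor \<open>K\<close> keeps the new power of \<open>p\<close> congruent to
    \<open>p\<close> modulo \<open>K\<close>; the squares serve all shifts at once.\<close>
  define Q where "Q = K * (\<Prod>q\<in>H. (K * n + q) ^ 2)"
  have y_pos: "K * n + q > 0" if "q \<in> H" for q using H(2)[OF that] by simp
  have cop_y: "coprime p (K * n + q)" if "q \<in> H" for q
  proof -
    have "p dvd K * n + p" using n by simp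
    then have "p dvd K * n" by (metis dvd_add_left_iff dvd_refl)
    moreover have "\<not> p dvd q"
      using H(2)[OF that] p coprime_absorb_left not_prime_unit by blast
    ultimately have "\<not> p dvd K * n + q" by (simp add: dvd_add_right_iff)
    then show ?thesis using p by (rule prime_imp_coprime_nat[rotated])
  qed
  have "coprime p Q"
    unfolding Q_def using K cop_y by (auto intro!: prod_coprime_right)
  have "Q > 0" unfolding Q_def using K y_pos H(1) by (auto intro!: prod_pos)
  have "[p ^ totient Q = 1] (mod Q)" using \<open>coprime p Q\<close> by (rule euler_theorem)
  then have "[p ^ e * p ^ totient Q = p ^ e * 1] (mod Q)" by (rule cong_scalar_left)
  then have "Q dvd p ^ e * p ^ totient Q - p ^ e"
    using p by (intro cong_altdef_nat[THEN iffD1]) (auto simp: prime_gt_0_nat Suc_le_eq)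
  then obtain t where t: "p ^ e * p ^ totient Q - p ^ e = Q * t" by (elim dvdE)
  have "p ^ e < p ^ (e + totient Q)"
    using prime_gt_1_nat[OF p] \<open>Q > 0\<close> by (intro power_strict_increasing) auto
  with t have "Q * t > 0" and e': "p ^ (e + totient Q) = p ^ e + Q * t"
    unfolding power_add by linarith+
  then have "t > 0" by simp
  define n' where "n' = n + (\<Prod>q\<in>H. (K * n + q) ^ 2) * t"
  have Kn': "K * n' = K * n + Q * t" by (simp add: n'_def Q_def algebra_simps)
  have "Suc m \<le> card (prime_factors (K * n' + q))" if q: "q \<in> H" for q
  proof -
    define y where "y = K * n + q"
    have "y ^ 2 dvd (\<Prod>q\<in>H. (K * n + q) ^ 2)"
      unfolding y_def using H(1) q by (rule dvd_prodI)
    then have "y ^ 2 dvd Q * t" by (simp add: Q_def)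
    then obtain u where u: "Q * t = y ^ 2 * u" by (elim dvdE)
    have "u > 0" using u \<open>Q > 0\<close> \<open>t > 0\<close> by (auto intro: Nat.gr0I)
    have "coprime y (y * u + 1)" by (rule coprimeI) (metis dvd_add_right_iff dvd_mult2)
    moreover have "y > 0" using y_pos[OF q] by (simp add: y_def)
    ultimately have "card (prime_factors y) < card (prime_factors (y * (y * u + 1)))"
      using \<open>u > 0\<close> by (intro card_prime_factors_mult_coprime_less) auto
    also have "y * (y * u + 1) = K * n' + q"
      using Kn' u by (simp add: y_def algebra_simps power2_eq_square)
    finally show ?thesis using m[OF q] by (simp add: y_def)
  qed
  moreover have "n' > 0" "e + totient Q > 0" "K * n' + p = p ^ (e + totient Q)"
    using n Kn' e' by (auto simp: n'_def)
  ultimately show ?case by blast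
qed

theorem theorem3p3:
  fixes k :: nat
  assumes "k \<ge> 2"
  shows "\<not> k_regular 1 k (\<lambda>n. int (totient n))"
proof
  assume "k_regular 1 k (\<lambda>n. int (totient n))"
  then obtain B where B: "finite B" "k_kernel 1 k (\<lambda>n. int (totient n)) \<subseteq> int_span B"
    unfolding k_regular_def by blast
  \<comment> \<open>Primes above \<open>k + 2\<close> are odd and coprime to
    \<open>k\<close>.\<close>
  have "infinite ({p::nat. prime p} - {..k + 2})"
    using primes_infinite by (intro Diff_infinite_finite) auto
  then obtain J where J: "J \<subseteq> {p::nat. prime p} - {..k + 2}" "finite J" "card J = Suc (card B)"
    using infinite_arbitrarily_large by metis
  have J_prime: "prime p" and J_gt: "p > k + 2" if "p \<in> J" for p using J that by auto
  \<comment> \<open>This exponent makes \<open>K\<close> exceed every \<open>p\<close> in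
    \<open>J\<close>, so that \<open>p\<close> is an admissible remainder in the kernel.\<close>
  define K where "K = k ^ Max J"
  have "K > 0" using assms by (simp add: K_def)
  have "\<exists>a. \<forall>i. int (totient (K * (1 + i) + p)) = (\<Sum>b\<in>B. a b * b i)" if "p \<in> J" for p
  proof -
    have "p \<le> Max J" using J that by simp
    also have "\<dots> < k ^ Max J" using assms by (intro power_gt_expt) auto
    finally have "(\<lambda>i. int (totient (K * (1 + i) + p))) \<in> k_kernel 1 k (\<lambda>n. int (totient n))"
      unfolding k_kernel_def K_def by blast
    then have "(\<lambda>i. int (totient (K * (1 + i) + p))) \<in> int_span B" using B by blast
    then show ?thesis unfolding int_span_def by (auto simp: fun_eq_iff)
  qed
  then obtain a where a:
    "\<And>p i. p \<in> J \<Longrightarrow> int (totient (K * (1 + i) + p)) = (\<Sum>b\<in>B. a p b * b i)"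
    by metis
  \<comment> \<open>The relation is found between the coefficient vectors \<open>a p\<close>; it
    then passes to the kernel sequences.\<close>
  obtain c p where c: "p \<in> J" "c p \<noteq> 0" "\<And>b. b \<in> B \<Longrightarrow> (\<Sum>p\<in>J. c p * a p b) = 0"
    using exists_integer_relation[OF B(1) J(2), of a] J(3) by auto
  have rel: "(\<Sum>q\<in>J. c q * int (totient (K * n + q))) = 0" if n: "n > 0" for n
  proof -
    obtain i where i: "n = 1 + i" using n by (cases n) auto
    have "(\<Sum>q\<in>J. c q * int (totient (K * n + q))) = (\<Sum>q\<in>J. \<Sum>b\<in>B. c q * a q b * b i)"
      unfolding i by (intro sum.cong) (simp_all only: a sum_distrib_left mult.assoc)
    also have "\<dots> = (\<Sum>b\<in>B. (\<Sum>q\<in>J. c q * a q b) * b i)"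
      by (subst sum.swap) (simp add: sum_distrib_right)
    also have "\<dots> = 0" using c(3) by simp
    finally show ?thesis .
  qed
  have p: "prime p" "p > k + 2" using J_prime J_gt c(1) by auto
  define M where "M = nat \<bar>c p * (int p - 1)\<bar>"
  have "coprime p k" using p assms by (intro prime_imp_coprime_nat) (auto dest: dvd_imp_le)
  then have "coprime p K" by (simp add: K_def)
  moreover have "coprime p q \<and> q > 0" if "q \<in> J - {p}" for q
    using that p J_prime[of q] by (auto intro: primes_coprime prime_gt_0_nat)
  \<comment> \<open>\<open>Suc M\<close> meets the strict bound in
    \<open>two_power_dvd_totient\<close>.\<close>
  ultimately obtain n e where n: "n > 0" "e > 0" "K * n + p = p ^ e"
    and many: "\<And>q. q \<in> J - {p} \<Longrightarrow> Suc M \<le> card (prime_factors (K * n + q))"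
    using prime_power_with_many_prime_factors_in_shifts[OF p(1) _ \<open>K > 0\<close>, of "J - {p}" "Suc M"]
      J(2) by blast
  have "2 ^ M dvd c q * int (totient (K * n + q))" if "q \<in> J - {p}" for q
  proof -
    have "2 ^ M dvd totient (K * n + q)" using many[OF that] by (intro two_power_dvd_totient) simp
    then have "int (2 ^ M) dvd int (totient (K * n + q))" by (simp only: int_dvd_int_iff)
    then show ?thesis by simp
  qed
  then have "2 ^ M dvd (\<Sum>q\<in>J - {p}. c q * int (totient (K * n + q)))" by (rule dvd_sum)
  moreover have "c p * int (totient (K * n + p)) = - (\<Sum>q\<in>J - {p}. c q * int (totient (K * n + q)))"
    using rel[OF n(1)] unfolding sum.remove[OF J(2) c(1)] by linarith
  ultimately have "2 ^ M dvd c p * int (totient (p ^ e))" using n(3) by simp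
  also have "int (totient (p ^ e)) = int p ^ (e - 1) * (int p - 1)"
    using p n(2) by (simp add: totient_prime_power of_nat_diff)
  finally have "2 ^ M dvd int p ^ (e - 1) * (c p * (int p - 1))" by (simp add: mult_ac)
  \<comment> \<open>The power of \<open>p\<close> varies with \<open>M\<close> through
    \<open>e\<close>, but it is odd and cancels; what remains is a fixed nonzero integer, of
    absolute value \<open>M < 2 ^ M\<close>.\<close>
  moreover have "odd p" using p prime_odd_nat by auto
  then have "coprime (2 ^ M) (int p ^ (e - 1))" by simp
  ultimately have "2 ^ M dvd c p * (int p - 1)" by (simp add: coprime_dvd_mult_right_iff)
  moreover have "c p * (int p - 1) \<noteq> 0" using c p by auto
  ultimately have "\<bar>2 ^ M\<bar> \<le> \<bar>c p * (int p - 1)\<bar>" by (intro dvd_imp_le_int)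
  also have "\<dots> = int M" by (simp add: M_def)
  finally have "2 ^ M \<le> int M" by simp
  moreover have "M < 2 ^ M" by (rule less_exp)
  then have "int M < int (2 ^ M)" by (simp only: of_nat_less_iff)
  ultimately show False by simp
qed

end
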